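(* Let $d$ be even. If $\boldsymbol X^{\ast}$ is a random vector with pmf in $\mathcal{PB}_d$ that is a $\Sigma_{cx}$-smallest element of $\mathcal{SB}_d$, and $U$ is a standard uniform random variable independent of $\boldsymbol X^{\ast}$, then $\boldsymbol V^{\ast}=U\boldsymbol X^{\ast}+(1-U)(\boldsymbol 1_d-\boldsymbol X^{\ast})$ is a joint mix.
   Context: $\boldsymbol 1_d$ is the all-ones vector of length $d$. $\mathcal{SB}_d$ is the class of probability mass functions (pmfs) $f:\{0,1\}^d\to[0,1]$ of random vectors whose one-dimensional marginals are all Bernoulli with mean $1/2$. $\mathcal{PB}_d$ is the class of palindromic Bernoulli pmfs, i.e. pmfs $f$ on $\{0,1\}^d$ with $f(\boldsymbol x)=f(\boldsymbol 1_d-\boldsymbol x)$ for all $\boldsymbol x\in\{0,1\}^d$. Convex order: for random variables with finite mean, $Y_1\le_{cx}Y_2$ if $E[\phi(Y_1)]\le E[\phi(Y_2)]$ for all convex $\phi:\mathbb{R}\to\mathbb{R}$ for which the expectations are finite. A random vector $\boldsymbol X$ with pmf in $\mathcal{SB}_d$ is a $\Sigma_{cx}$-smallest element of $\mathcal{SB}_d$ if $\sum_{j=1}^dX_j\le_{cx}\sum_{j=1}^dX'_j$ for every random vector $\boldsymbol X'$ with pmf in $\mathcal{SB}_d$. A random vector $\boldsymbol Y=(Y_1,\dots,Y_d)$ is a joint mix if there is $k\in\mathbb{R}$ with $\mathbb{P}(\sum_{j=1}^dY_j=k)=1$. *)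

theory Defs
  imports "HOL-Probability.Probability"
begin

text \<open>The dimension \<open>d\<close> is \<open>CARD('n)\<close>; the all-ones vector is \<open>1 :: real ^ 'n\<close>.\<close>

definition cube :: "(real ^ 'n) set" where
  "cube = {x. \<forall>i. x $ i \<in> {0, 1}}"

definition SB :: "(real ^ 'n) pmf set" where
  "SB = {p. set_pmf p \<subseteq> cube \<and>
        (\<forall>i. map_pmf (\<lambda>x. x $ i) p = map_pmf of_bool (bernoulli_pmf (1/2)))}"

definition PB :: "(real ^ 'n) pmf set" where
  "PB = {p. set_pmf p \<subseteq> cube \<and> (\<forall>x\<in>cube. pmf p x = pmf p (1 - x))}"

definition has_pmf :: "'a measure \<Rightarrow> ('a \<Rightarrow> real ^ 'n) \<Rightarrow> (real ^ 'n) pmf \<Rightarrow> bool" where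
  "has_pmf M X p \<longleftrightarrow> X \<in> borel_measurable M \<and>
     (\<forall>x. measure M {\<omega> \<in> space M. X \<omega> = x} = pmf p x)"

text \<open>The two random variables may live on different probability spaces.\<close>

definition cx_le :: "'a measure \<Rightarrow> ('a \<Rightarrow> real) \<Rightarrow> 'b measure \<Rightarrow> ('b \<Rightarrow> real) \<Rightarrow> bool" where
  "cx_le M Y N Z \<longleftrightarrow> integrable M Y \<and> integrable N Z \<and>
     (\<forall>\<phi> :: real \<Rightarrow> real. convex_on UNIV \<phi> \<longrightarrow>
        integrable M (\<lambda>\<omega>. \<phi> (Y \<omega>)) \<longrightarrow> integrable N (\<lambda>\<omega>. \<phi> (Z \<omega>)) \<longrightarrow>
        (LINT \<omega>|M. \<phi> (Y \<omega>)) \<le> (LINT \<omega>|N. \<phi> (Z \<omega>)))"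

text \<open>HOL cannot quantify over the type of sample points of the competitor \<open>X'\<close> inside a
  definition. It is fixed to \<open>real ^ 'n\<close>, which loses nothing: the convex order depends only on the
  laws, and every law on \<open>real ^ 'n\<close> is realised by the identity on a probability space over
  that type.\<close>

definition Sigma_cx_smallest_SB :: "'a measure \<Rightarrow> ('a \<Rightarrow> real ^ 'n) \<Rightarrow> bool" where
  "Sigma_cx_smallest_SB M X \<longleftrightarrow> (\<exists>p\<in>SB. has_pmf M X p) \<and>
     (\<forall>(N :: (real ^ 'n) measure) (X' :: real ^ 'n \<Rightarrow> real ^ 'n).
        prob_space N \<longrightarrow> (\<exists>q\<in>SB. has_pmf N X' q) \<longrightarrow>
        cx_le M (\<lambda>\<omega>. \<Sum>j\<in>UNIV. X \<omega> $ j) N (\<lambda>\<omega>. \<Sum>j\<in>UNIV. X' \<omega> $ j))"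

definition joint_mix :: "'a measure \<Rightarrow> ('a \<Rightarrow> real ^ 'n) \<Rightarrow> bool" where
  "joint_mix M Y \<longleftrightarrow> Y \<in> borel_measurable M \<and>
     (\<exists>k. measure M {\<omega> \<in> space M. (\<Sum>j\<in>UNIV. Y \<omega> $ j) = k} = 1)"

text \<open>The library constant \<^const>\<open>prob_space.indep_var\<close> requires both variables to have the same
  codomain type; this is independence of the generated sigma-algebras for variables of
  different types.\<close>

definition indep_rv :: "'a measure \<Rightarrow> ('a \<Rightarrow> 'b :: topological_space) \<Rightarrow>
    ('a \<Rightarrow> 'c :: topological_space) \<Rightarrow> bool" where
  "indep_rv M X Y \<longleftrightarrow> X \<in> borel_measurable M \<and> Y \<in> borel_measurable M \<and>
     prob_space.indep_set M (sets (vimage_algebra (space M) X borel))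
       (sets (vimage_algebra (space M) Y borel))"

end

theory Submission
  imports Defs
begin

text \<open>For even \<open>d\<close>, the uniform law on \<open>1\<^sub>S\<close> and its complement, with \<open>|S| = d/2\<close>, lies in
  \<open>SB\<close> and has constant sum \<open>d/2\<close>. Comparing against it with the convex function
  \<open>y \<mapsto> |y - d/2|\<close> forces the sum of a \<open>\<Sigma>\<close>-smallest \<open>X\<close> to be \<open>d/2\<close> almost surely, and then
  \<open>\<Sum>\<^sub>j V\<^sub>j = U d/2 + (1 - U) (d - d/2) = d/2\<close>.\<close>

text \<open>A fair coin is uniform on \<open>bool\<close>, and \<open>Not\<close> permutes
  \<open>bool\<close>. This supplies the marginals at coordinates that carry a negated coin.\<close>

lemma map_Not_bernoulli_half: "map_pmf Not (bernoulli_pmf (1/2)) = bernoulli_pmf (1/2)"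
proof -
  have "map_pmf Not (pmf_of_set UNIV) = pmf_of_set (Not ` UNIV)"
    by (intro map_pmf_of_set_inj) (auto simp: inj_on_def)
  also have "Not ` UNIV = UNIV"
    by (auto simp: UNIV_bool)
  finally show ?thesis
    by (simp add: bernoulli_pmf_half_conv_pmf_of_set)
qed

lemma exists_constant_sum_SB:
  assumes "even CARD('n)"
  obtains q :: "(real ^ 'n) pmf"
  where "q \<in> SB" "\<And>x. x \<in> set_pmf q \<Longrightarrow> (\<Sum>j\<in>UNIV. x $ j) = CARD('n) / 2"
proof -
  obtain S :: "'n set" where card_S: "card S = CARD('n) div 2"
    by (meson div_le_dividend obtain_subset_with_card_n)
  \<comment> \<open>A single coin \<open>b\<close> drives all coordinates: \<open>v True\<close> is
    the indicator of \<open>S\<close>, \<open>v False\<close> that of its complement. Coordinate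
    \<open>i\<close> is thus \<open>b\<close> inside \<open>S\<close> and its negation
    outside.\<close>
  define v :: "bool \<Rightarrow> real ^ 'n" where "v b = (\<chi> i. of_bool (b = (i \<in> S)))" for b
  define q where "q = map_pmf v (bernoulli_pmf (1/2))"
  have "map_pmf (\<lambda>x. x $ i) q = map_pmf of_bool (bernoulli_pmf (1/2))" for i
  proof (cases "i \<in> S")
    case True
    then show ?thesis
      by (simp add: q_def v_def map_pmf_comp)
  next
    case False
    then have "map_pmf (\<lambda>x. x $ i) q = map_pmf of_bool (map_pmf Not (bernoulli_pmf (1/2)))"
      by (simp add: q_def v_def map_pmf_comp)
    then show ?thesis
      by (simp only: map_Not_bernoulli_half)
  qed
  moreover have "set_pmf q \<subseteq> cube"
    by (auto simp: q_def v_def cube_def)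
  ultimately have "q \<in> SB"
    by (simp add: SB_def)
  moreover have "(\<Sum>j\<in>UNIV. v b $ j) = CARD('n) / 2" for b
  proof -
    have "(\<Sum>j\<in>UNIV. v b $ j) = card {j. b = (j \<in> S)}"
      by (simp add: v_def of_bool_def sum.If_cases Int_def)
    also have "{j. b = (j \<in> S)} = (if b then S else - S)"
      by auto
    \<comment> \<open>Evenness makes the complement of \<open>S\<close> exactly as large as
      \<open>S\<close>.\<close>
    also have "card \<dots> = CARD('n) div 2"
      using card_S assms by (auto simp: card_Diff_subset Compl_eq_Diff_UNIV elim!: evenE)
    finally show ?thesis
      using assms by (simp add: real_of_nat_div)
  qed
  ultimately show ?thesis
    by (intro that[of q]) (auto simp: q_def)
qed

lemma Sigma_cx_smallest_SB_sum:
  fixes X :: "'a \<Rightarrow> real ^ 'n"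
  assumes "prob_space M" and "even CARD('n)" and "Sigma_cx_smallest_SB M X"
  shows "AE \<omega> in M. (\<Sum>j\<in>UNIV. X \<omega> $ j) = CARD('n) / 2"
proof -
  interpret prob_space M by fact
  define c :: real where "c = CARD('n) / 2"
  obtain q :: "(real ^ 'n) pmf"
    where q: "q \<in> SB" and sum_q: "\<And>x. x \<in> set_pmf q \<Longrightarrow> (\<Sum>j\<in>UNIV. x $ j) = c"
    using exists_constant_sum_SB[OF assms(2)] unfolding c_def by metis
  let ?Y = "\<lambda>\<omega>. \<Sum>j\<in>UNIV. X \<omega> $ j"
  let ?Z = "\<lambda>x :: real ^ 'n. \<Sum>j\<in>UNIV. x $ j"
  have "prob_space (measure_pmf q)"
    by (rule prob_space_measure_pmf)
  \<comment> \<open>The competitor is the identity on \<open>real ^ 'n\<close> under the law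
    \<open>q\<close>, so its sample space has the type that \<open>Sigma_cx_smallest_SB\<close>
    quantifies over.\<close>
  moreover have "has_pmf (measure_pmf q) (\<lambda>x. x) q"
    by (simp add: has_pmf_def pmf.rep_eq)
  ultimately have cx: "cx_le M ?Y (measure_pmf q) ?Z"
    using assms(3) q unfolding Sigma_cx_smallest_SB_def by blast
  then have int_Y: "integrable M ?Y"
    by (simp add: cx_le_def)
  have AE_Z: "AE x in measure_pmf q. \<bar>?Z x - c\<bar> = 0"
    by (simp add: AE_measure_pmf_iff sum_q)
  \<comment> \<open>\<open>cx_le\<close> compares expectations only when both are finite, so
    integrability is established on each side first.\<close>
  then have int_Z: "integrable (measure_pmf q) (\<lambda>x. \<bar>?Z x - c\<bar>)"
    by (subst integrable_cong_AE[where g = "\<lambda>_. 0"]) auto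
  have int_Y': "integrable M (\<lambda>\<omega>. \<bar>?Y \<omega> - c\<bar>)"
    using int_Y by simp
  have "convex_on UNIV (\<lambda>y::real. \<bar>y - c\<bar>)"
    using convex_on_dist[of UNIV c] by (simp add: dist_real_def abs_minus_commute)
  then have "(LINT \<omega>|M. \<bar>?Y \<omega> - c\<bar>) \<le> (LINT x|measure_pmf q. \<bar>?Z x - c\<bar>)"
    using cx int_Y' int_Z unfolding cx_le_def by blast
  also have "\<dots> = 0"
    using integral_cong_AE[OF _ _ AE_Z] by simp
  \<comment> \<open>The integrand is nonnegative, so the upper bound 0 is attained.\<close>
  finally have "(LINT \<omega>|M. \<bar>?Y \<omega> - c\<bar>) = 0"
    by (simp add: antisym)
  then have "AE \<omega> in M. \<bar>?Y \<omega> - c\<bar> = 0"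
    using integral_nonneg_eq_0_iff_AE[OF int_Y'] by simp
  then show ?thesis
    by (simp add: c_def)
qed

theorem proposition3p7:
  fixes M :: "'a measure" and X :: "'a \<Rightarrow> real ^ 'n" and U :: "'a \<Rightarrow> real"
  assumes "prob_space M"
    and "even CARD('n)"
    and "\<exists>p\<in>PB. has_pmf M X p"
    and "Sigma_cx_smallest_SB M X"
    and "distributed M lborel U (indicator {0..1})"
    and "indep_rv M U X"
  shows "joint_mix M (\<lambda>\<omega>. U \<omega> *\<^sub>R X \<omega> + (1 - U \<omega>) *\<^sub>R (1 - X \<omega>))"
proof -
  interpret prob_space M by fact
  let ?V = "\<lambda>\<omega>. U \<omega> *\<^sub>R X \<omega> + (1 - U \<omega>) *\<^sub>R (1 - X \<omega>)"
  have [measurable]: "U \<in> borel_measurable M" "X \<in> borel_measurable M"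
    using assms(6) by (auto simp: indep_rv_def)
  have V [measurable]: "?V \<in> borel_measurable M"
    by measurable
  have "AE \<omega> in M. (\<Sum>j\<in>UNIV. ?V \<omega> $ j) = CARD('n) / 2"
    using Sigma_cx_smallest_SB_sum[OF assms(1,2,4)]
  proof eventually_elim
    case (elim \<omega>)
    have "(\<Sum>j\<in>UNIV. ?V \<omega> $ j) = U \<omega> * (\<Sum>j\<in>UNIV. X \<omega> $ j)
        + (1 - U \<omega>) * (CARD('n) - (\<Sum>j\<in>UNIV. X \<omega> $ j))"
      by (simp add: sum.distrib sum_subtractf flip: sum_distrib_left)
    \<comment> \<open>\<open>X\<close> and \<open>1 - X\<close> both have coordinate sum d/2, and
      the weights \<open>U\<close> and \<open>1 - U\<close> add up to 1.\<close>
    also have "\<dots> = CARD('n) / 2"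
      unfolding elim by (simp add: field_simps)
    finally show ?case .
  qed
  then have "prob {\<omega> \<in> space M. (\<Sum>j\<in>UNIV. ?V \<omega> $ j) = CARD('n) / 2} = 1"
    by (subst prob_Collect_eq_1) measurable
  then show ?thesis
    using V unfolding joint_mix_def by blast
qed

end
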